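(* Let $\alpha>0$ and $\beta,\gamma,\delta\ge 0$ be real numbers, let $\lambda\in\mathbb{R}$, let $t>0$, let $$G=\begin{bmatrix}0&1\\ -\alpha\lambda-\delta&-\beta\lambda-\gamma\end{bmatrix},$$ and denote $m=-\tfrac12(\beta\lambda+\gamma)$. (i) If $(\beta\lambda+\gamma)^2>4(\alpha\lambda+\delta)$, then with $n=\tfrac12\sqrt{(\beta\lambda+\gamma)^2-4(\alpha\lambda+\delta)}$, $$\mathrm{e}^{tG}=\frac{\mathrm{e}^{t(m+n)}-\mathrm{e}^{t(m-n)}}{2n}\begin{bmatrix}-m-n&1\\ n^2-m^2&m-n\end{bmatrix}+\mathrm{e}^{t(m+n)}I.$$ (ii) If $(\beta\lambda+\gamma)^2=4(\alpha\lambda+\delta)$, then $$\mathrm{e}^{tG}=\mathrm{e}^{tm}\begin{bmatrix}1-tm&t\\ -tm^2&tm+1\end{bmatrix}.$$ (iii) If $(\beta\lambda+\gamma)^2<4(\alpha\lambda+\delta)$, then with $n=\tfrac12\sqrt{4(\alpha\lambda+\delta)-(\beta\lambda+\gamma)^2}$, $$\mathrm{e}^{tG}=\frac{\mathrm{e}^{tm}\sin(tn)}{n}\begin{bmatrix}-m&1\\ -n^2-m^2&m\end{bmatrix}+\mathrm{e}^{tm}\cos(tn)\,I.$$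
   Context: $I$ denotes the $2\times2$ identity matrix and $\mathrm{e}^{tG}$ the matrix exponential. *)

theory Defs
  imports "HOL-Analysis.Analysis"
begin

(* The multiplication and power operators of the type classes act componentwise on
   real ^ 'n ^ 'n, and exp is not available there (no real_normed_algebra_1 instance).
   So powers are taken with respect to the matrix product, and the exponential is its
   power series. *)

primrec matrix_power :: "real ^ 'n ^ 'n \<Rightarrow> nat \<Rightarrow> real ^ 'n ^ 'n" where
  "matrix_power A 0 = mat 1"
| "matrix_power A (Suc k) = A ** matrix_power A k"

definition matrix_exp :: "real ^ 'n ^ 'n \<Rightarrow> real ^ 'n ^ 'n" where
  "matrix_exp A = (\<Sum>k. (1 / fact k) *\<^sub>R matrix_power A k)"

lemma bounded_bilinear_matrix_mult:
  "bounded_bilinear ((**) :: real ^ 'n ^ 'n \<Rightarrow> real ^ 'n ^ 'n \<Rightarrow> real ^ 'n ^ 'n)"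
  unfolding bilinear_conv_bounded_bilinear[symmetric] bilinear_def
  by (simp add: linear_iff matrix_matrix_mult_def vec_eq_iff
      distrib_left distrib_right sum.distrib sum_distrib_left mult_ac)

(* The series converges for every matrix, so matrix_exp never takes the arbitrary value
   that suminf has on divergent series. *)

lemma matrix_exp_sums:
  fixes A :: "real ^ 'n ^ 'n"
  shows "(\<lambda>k. (1 / fact k) *\<^sub>R matrix_power A k) sums matrix_exp A"
proof -
  obtain K where K: "K > 0" "\<And>(A :: real ^ 'n ^ 'n) (B :: real ^ 'n ^ 'n). norm (A ** B) \<le> norm A * norm B * K"
    using bounded_bilinear.pos_bounded[OF bounded_bilinear_matrix_mult] by blast
  have bound: "norm (matrix_power A k) \<le> norm (mat 1 :: real ^ 'n ^ 'n) * (norm A * K) ^ k" for k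
  proof (induction k)
    case (Suc k)
    have "norm (matrix_power A (Suc k)) \<le> (norm A * K) * norm (matrix_power A k)"
      using K(2)[of A "matrix_power A k"] by (simp only: matrix_power.simps mult_ac)
    also have "\<dots> \<le> (norm A * K) * (norm (mat 1 :: real ^ 'n ^ 'n) * (norm A * K) ^ k)"
      by (rule mult_left_mono[OF Suc.IH]) (use K(1) in simp)
    finally show ?case by (simp only: power_Suc mult_ac)
  qed simp
  have "summable (\<lambda>k. norm (mat 1 :: real ^ 'n ^ 'n) * (inverse (fact k) * (norm A * K) ^ k))"
    by (rule summable_mult[OF summable_exp])
  then have "summable (\<lambda>k. (1 / fact k) *\<^sub>R matrix_power A k)"
  proof (rule summable_comparison_test')
    fix k :: nat
    show "norm ((1 / fact k) *\<^sub>R matrix_power A k)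
        \<le> norm (mat 1 :: real ^ 'n ^ 'n) * (inverse (fact k) * (norm A * K) ^ k)"
      using mult_left_mono[OF bound[of k], of "inverse (fact k)"]
      by (simp add: divide_inverse mult.left_commute)
  qed
  then show ?thesis
    unfolding matrix_exp_def by (rule summable_sums)
qed

end

theory Submission
  imports Defs
begin

text \<open>
  If \<open>A\<close> satisfies a quadratic equation, then every power of \<open>A\<close> is a combination of
  \<open>N\<close> and the identity, where \<open>N\<close> is \<open>A\<close> minus a root, or minus the real part of the
  roots when these are not real. The coefficients are \<open>(x ^ k - y ^ k) / (x - y)\<close> and
  \<open>x ^ k\<close> for distinct real roots \<open>x\<close>, \<open>y\<close>, their limits for \<open>y = x\<close>, and
  \<open>Im (z ^ k) / Im z\<close> and \<open>Re (z ^ k)\<close> for a nonreal root \<open>z\<close>. Summing the exponential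
  series coefficientwise gives the exponential.
\<close>

text \<open>Reduces the exponential to two scalar series: scaling a fixed matrix is bounded linear
  in the scalar, so sums pass through it, and a series has at most one sum.\<close>

lemma matrix_exp_eqI:
  fixes A N :: "real ^ 'n ^ 'n"
  assumes power: "\<And>k. matrix_power A k = a k *\<^sub>R N + b k *\<^sub>R mat 1"
    and a: "(\<lambda>k. a k / fact k) sums u" and b: "(\<lambda>k. b k / fact k) sums v"
  shows "matrix_exp A = u *\<^sub>R N + v *\<^sub>R mat 1"
proof -
  have "(\<lambda>k. (a k / fact k) *\<^sub>R N + (b k / fact k) *\<^sub>R mat 1)
      sums (u *\<^sub>R N + v *\<^sub>R mat 1)"
    by (intro sums_add bounded_linear.sums[OF bounded_linear_scaleR_left] a b)
  moreover have "(1 / fact k) *\<^sub>R matrix_power A k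
      = (a k / fact k) *\<^sub>R N + (b k / fact k) *\<^sub>R mat 1" for k
    by (simp add: power scaleR_add_right)
  ultimately show ?thesis
    using matrix_exp_sums[of A] sums_unique2 by (metis (no_types, lifting) sums_cong)
qed

lemma real_exp_sums: "(\<lambda>k. x ^ k / fact k) sums exp (x :: real)"
  using exp_converges[of x] by (simp add: divide_inverse mult.commute)

lemma matrix_mult_lincomb_mat_1:
  fixes A N :: "real ^ 'n ^ 'n"
  shows "A ** (u *\<^sub>R N + v *\<^sub>R mat 1) = u *\<^sub>R (A ** N) + v *\<^sub>R A"
proof -
  interpret bounded_bilinear "(**) :: real ^ 'n ^ 'n \<Rightarrow> real ^ 'n ^ 'n \<Rightarrow> _"
    by (rule bounded_bilinear_matrix_mult)
  show ?thesis
    by (simp add: add_right scaleR_right)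
qed

text \<open>The hypotheses say \<open>(A - y I) (A - x I) = 0\<close>. They are phrased through
  \<open>N\<close> because multiplication by \<open>A\<close> then sends \<open>N\<close> to
  \<open>y N\<close> and \<open>I\<close> to \<open>N + x I\<close>. The coefficients thus obey
  \<open>a (Suc k) = y * a k + b k\<close> and \<open>b (Suc k) = x * b k\<close>.\<close>

lemma matrix_exp_distinct_roots:
  fixes A N :: "real ^ 'n ^ 'n"
  assumes A: "A = N + x *\<^sub>R mat 1" and AN: "A ** N = y *\<^sub>R N" and "x \<noteq> y"
  shows "matrix_exp A = ((exp x - exp y) / (x - y)) *\<^sub>R N + exp x *\<^sub>R mat 1"
proof (rule matrix_exp_eqI)
  fix k
  show "matrix_power A k = ((x ^ k - y ^ k) / (x - y)) *\<^sub>R N + x ^ k *\<^sub>R mat 1"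
  proof (induction k)
    case (Suc k)
    have "matrix_power A (Suc k)
        = ((x ^ k - y ^ k) / (x - y)) *\<^sub>R (y *\<^sub>R N) + x ^ k *\<^sub>R (N + x *\<^sub>R mat 1)"
      by (simp only: matrix_power.simps Suc.IH matrix_mult_lincomb_mat_1 AN flip: A)
    also have "\<dots> = ((x ^ k - y ^ k) / (x - y) * y + x ^ k) *\<^sub>R N + x ^ Suc k *\<^sub>R mat 1"
      by (simp add: scaleR_add_left scaleR_add_right mult.commute)
    also have "(x ^ k - y ^ k) / (x - y) * y + x ^ k = (x ^ Suc k - y ^ Suc k) / (x - y)"
      using \<open>x \<noteq> y\<close> by (simp add: field_simps)
    finally show ?case .
  qed simp
next
  have "(\<lambda>k. (x ^ k / fact k - y ^ k / fact k) / (x - y)) sums ((exp x - exp y) / (x - y))"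
    by (intro sums_divide sums_diff real_exp_sums)
  then show "(\<lambda>k. (x ^ k - y ^ k) / (x - y) / fact k) sums ((exp x - exp y) / (x - y))"
    by (simp add: diff_divide_distrib mult.commute)
qed (rule real_exp_sums)

text \<open>Here \<open>N\<close> squares to zero, so the binomial expansion of
  \<open>(x I + N) ^ k\<close> stops after the linear term.\<close>

lemma matrix_exp_double_root:
  fixes A N :: "real ^ 'n ^ 'n"
  assumes A: "A = N + x *\<^sub>R mat 1" and AN: "A ** N = x *\<^sub>R N"
  shows "matrix_exp A = exp x *\<^sub>R N + exp x *\<^sub>R mat 1"
proof (rule matrix_exp_eqI)
  fix k
  show "matrix_power A k = (real k * x ^ (k - 1)) *\<^sub>R N + x ^ k *\<^sub>R mat 1"
  proof (induction k)
    case (Suc k)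
    have "matrix_power A (Suc k)
        = (real k * x ^ (k - 1)) *\<^sub>R (x *\<^sub>R N) + x ^ k *\<^sub>R (N + x *\<^sub>R mat 1)"
      by (simp only: matrix_power.simps Suc.IH matrix_mult_lincomb_mat_1 AN flip: A)
    also have "\<dots> = (real k * x ^ (k - 1) * x + x ^ k) *\<^sub>R N + x ^ Suc k *\<^sub>R mat 1"
      by (simp add: scaleR_add_left scaleR_add_right mult.commute)
    \<comment> \<open>Merging \<open>x ^ (k - 1) * x\<close> into \<open>x ^ k\<close> fails at
      \<open>k = 0\<close>, where the factor \<open>real k\<close> vanishes; hence the case
      split.\<close>
    also have "real k * x ^ (k - 1) * x + x ^ k = real (Suc k) * x ^ (Suc k - 1)"
      by (cases k) (simp_all add: algebra_simps)
    finally show ?case .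
  qed simp
next
  \<comment> \<open>The term at index 0 is zero, so shifting the index by one turns the series into
    that of \<open>exp x\<close> with the same sum.\<close>
  have "real (Suc k) * x ^ (Suc k - 1) / fact (Suc k) = x ^ k / fact k" for k
    by simp
  then have "(\<lambda>k. real (Suc k) * x ^ (Suc k - 1) / fact (Suc k)) sums exp x"
    using real_exp_sums[of x] by presburger
  then show "(\<lambda>k. real k * x ^ (k - 1) / fact k) sums exp x"
    by (subst (asm) sums_Suc_iff) simp
qed (rule real_exp_sums)

text \<open>The hypotheses give \<open>N ** N = - s\<^sup>2 I\<close>, so \<open>N / s\<close>
  behaves like the imaginary unit and \<open>A\<close> like the complex number
  \<open>r + i s\<close>.\<close>

lemma matrix_exp_complex_roots:
  fixes A N :: "real ^ 'n ^ 'n"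
  assumes A: "A = N + r *\<^sub>R mat 1"
    and AN: "A ** N = r *\<^sub>R N - s\<^sup>2 *\<^sub>R mat 1" and "s \<noteq> 0"
  shows "matrix_exp A = (exp r * sin s / s) *\<^sub>R N + (exp r * cos s) *\<^sub>R mat 1"
proof -
  define z where "z = Complex r s"
  have z: "(\<lambda>k. z ^ k / fact k) sums exp z"
    using exp_converges[of z] by (simp add: scaleR_conv_of_real divide_inverse mult.commute)
  have exp_z: "Re (exp z) = exp r * cos s" "Im (exp z) = exp r * sin s"
    by (simp_all add: z_def Re_exp Im_exp)
  show ?thesis
  proof (rule matrix_exp_eqI)
    fix k
    show "matrix_power A k = (Im (z ^ k) / s) *\<^sub>R N + Re (z ^ k) *\<^sub>R mat 1"
    proof (induction k)
      case (Suc k)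
      have "matrix_power A (Suc k)
          = (Im (z ^ k) / s) *\<^sub>R (r *\<^sub>R N - s\<^sup>2 *\<^sub>R mat 1) + Re (z ^ k) *\<^sub>R (N + r *\<^sub>R mat 1)"
        by (simp only: matrix_power.simps Suc.IH matrix_mult_lincomb_mat_1 AN flip: A)
      also have "\<dots> = (Im (z ^ k) / s * r + Re (z ^ k)) *\<^sub>R N
          + (Re (z ^ k) * r - Im (z ^ k) / s * s\<^sup>2) *\<^sub>R mat 1"
        by (simp add: scaleR_add_left scaleR_add_right scaleR_diff_left scaleR_diff_right)
      \<comment> \<open>Both coefficient updates are multiplication by \<open>z\<close>, read off in
        real and imaginary parts.\<close>
      also have "Im (z ^ k) / s * r + Re (z ^ k) = Im (z ^ Suc k) / s"
        using \<open>s \<noteq> 0\<close> by (simp add: z_def field_simps)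
      also have "Re (z ^ k) * r - Im (z ^ k) / s * s\<^sup>2 = Re (z ^ Suc k)"
        using \<open>s \<noteq> 0\<close> by (simp add: z_def power2_eq_square)
      finally show ?case .
    qed simp
  next
    have "(\<lambda>k. Im (z ^ k / fact k) / s) sums (exp r * sin s / s)"
      unfolding exp_z[symmetric] by (intro sums_divide sums_Im z)
    \<comment> \<open>The complex factorial is real, so taking imaginary parts commutes with
      dividing by it.\<close>
    moreover have "Im (z ^ k / fact k) = Im (z ^ k) / fact k" for k
      using Im_divide_of_real[of "z ^ k" "fact k"] by simp
    ultimately show "(\<lambda>k. Im (z ^ k) / s / fact k) sums (exp r * sin s / s)"
      by (simp add: mult.commute)
  next
    have "(\<lambda>k. Re (z ^ k / fact k)) sums (exp r * cos s)"
      unfolding exp_z[symmetric] by (intro sums_Re z)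
    moreover have "Re (z ^ k / fact k) = Re (z ^ k) / fact k" for k
      using Re_divide_of_real[of "z ^ k" "fact k"] by simp
    ultimately show "(\<lambda>k. Re (z ^ k) / fact k) sums (exp r * cos s)"
      by simp
  qed
qed

text \<open>The matrix has trace \<open>2 * m\<close> and determinant
  \<open>m\<^sup>2 - n\<^sup>2\<close>, hence eigenvalues \<open>m + n\<close> and
  \<open>m - n\<close>.\<close>

lemma matrix_exp_companion_distinct:
  fixes m n t :: real
  assumes "n \<noteq> 0" and "t \<noteq> 0"
  shows "matrix_exp (t *\<^sub>R (vector [vector [0, 1], vector [n\<^sup>2 - m\<^sup>2, 2 * m]] :: real ^ 2 ^ 2)) =
      ((exp (t * (m + n)) - exp (t * (m - n))) / (2 * n)) *\<^sub>R
        vector [vector [- m - n, 1], vector [n\<^sup>2 - m\<^sup>2, m - n]]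
      + exp (t * (m + n)) *\<^sub>R mat 1"
    (is "matrix_exp (t *\<^sub>R ?G) = _ *\<^sub>R ?N + _")
proof -
  \<comment> \<open>The roots are scaled by \<open>t\<close> as well; their difference
    \<open>t * (2 * n)\<close> then cancels the \<open>t\<close> in front of
    \<open>?N\<close>.\<close>
  have "matrix_exp (t *\<^sub>R ?G) =
      ((exp (t * (m + n)) - exp (t * (m - n))) / (t * (m + n) - t * (m - n))) *\<^sub>R (t *\<^sub>R ?N)
      + exp (t * (m + n)) *\<^sub>R mat 1"
    by (rule matrix_exp_distinct_roots)
      (use assms in \<open>simp_all add: vec_eq_iff forall_2 sum_2 matrix_matrix_mult_def mat_def
        algebra_simps power2_eq_square\<close>)
  also have "t * (m + n) - t * (m - n) = t * (2 * n)"
    by (simp add: algebra_simps)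
  finally show ?thesis
    using assms by simp
qed

lemma matrix_exp_companion_double:
  fixes m t :: real
  shows "matrix_exp (t *\<^sub>R (vector [vector [0, 1], vector [- m\<^sup>2, 2 * m]] :: real ^ 2 ^ 2)) =
      exp (t * m) *\<^sub>R vector [vector [1 - t * m, t], vector [- t * m\<^sup>2, t * m + 1]]"
    (is "matrix_exp (t *\<^sub>R ?G) = _")
proof -
  have "matrix_exp (t *\<^sub>R ?G) =
      exp (t * m) *\<^sub>R (t *\<^sub>R vector [vector [- m, 1], vector [- m\<^sup>2, m]])
      + exp (t * m) *\<^sub>R mat 1"
    by (rule matrix_exp_double_root)
      (simp_all add: vec_eq_iff forall_2 sum_2 matrix_matrix_mult_def mat_def
        algebra_simps power2_eq_square)
  \<comment> \<open>The identity term is absorbed into the matrix, which produces the entries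
    \<open>1 - t * m\<close> and \<open>t * m + 1\<close>.\<close>
  then show ?thesis
    by (simp add: vec_eq_iff forall_2 mat_def algebra_simps)
qed

text \<open>The determinant is now \<open>m\<^sup>2 + n\<^sup>2\<close>, so the eigenvalues are
  \<open>m\<close> plus or minus \<open>i n\<close>; after scaling, \<open>r = t * m\<close> and
  \<open>s = t * n\<close>.\<close>

lemma matrix_exp_companion_complex:
  fixes m n t :: real
  assumes "n \<noteq> 0" and "t \<noteq> 0"
  shows "matrix_exp (t *\<^sub>R (vector [vector [0, 1], vector [- n\<^sup>2 - m\<^sup>2, 2 * m]] :: real ^ 2 ^ 2)) =
      (exp (t * m) * sin (t * n) / n) *\<^sub>R
        vector [vector [- m, 1], vector [- n\<^sup>2 - m\<^sup>2, m]]
      + (exp (t * m) * cos (t * n)) *\<^sub>R mat 1"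
    (is "matrix_exp (t *\<^sub>R ?G) = _ *\<^sub>R ?N + _")
proof -
  have "matrix_exp (t *\<^sub>R ?G) =
      (exp (t * m) * sin (t * n) / (t * n)) *\<^sub>R (t *\<^sub>R ?N)
      + (exp (t * m) * cos (t * n)) *\<^sub>R mat 1"
    by (rule matrix_exp_complex_roots)
      (use assms in \<open>simp_all add: vec_eq_iff forall_2 sum_2 matrix_matrix_mult_def mat_def
        algebra_simps power2_eq_square\<close>)
  then show ?thesis
    using assms by simp
qed

theorem lemma2p9:
  fixes \<alpha> \<beta> \<gamma> \<delta> lam t m :: real
    and G :: "real ^ 2 ^ 2"
  assumes "\<alpha> > 0" and "\<beta> \<ge> 0" and "\<gamma> \<ge> 0" and "\<delta> \<ge> 0"
    and "t > 0"
    and "G = vector [vector [0, 1],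
                     vector [- \<alpha> * lam - \<delta>, - \<beta> * lam - \<gamma>]]"
    and "m = - (1 / 2) * (\<beta> * lam + \<gamma>)"
  shows
    "((\<beta> * lam + \<gamma>)\<^sup>2 > 4 * (\<alpha> * lam + \<delta>) \<longrightarrow>
       (let n = (1 / 2) * sqrt ((\<beta> * lam + \<gamma>)\<^sup>2 - 4 * (\<alpha> * lam + \<delta>)) in
        matrix_exp (t *\<^sub>R G) =
          ((exp (t * (m + n)) - exp (t * (m - n))) / (2 * n)) *\<^sub>R
            vector [vector [- m - n, 1],
                    vector [n\<^sup>2 - m\<^sup>2, m - n]]
          + exp (t * (m + n)) *\<^sub>R mat 1)) \<and>
     ((\<beta> * lam + \<gamma>)\<^sup>2 = 4 * (\<alpha> * lam + \<delta>) \<longrightarrow>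
        matrix_exp (t *\<^sub>R G) =
          exp (t * m) *\<^sub>R
            vector [vector [1 - t * m, t],
                    vector [- t * m\<^sup>2, t * m + 1]]) \<and>
     ((\<beta> * lam + \<gamma>)\<^sup>2 < 4 * (\<alpha> * lam + \<delta>) \<longrightarrow>
       (let n = (1 / 2) * sqrt (4 * (\<alpha> * lam + \<delta>) - (\<beta> * lam + \<gamma>)\<^sup>2) in
        matrix_exp (t *\<^sub>R G) =
          (exp (t * m) * sin (t * n) / n) *\<^sub>R
            vector [vector [- m, 1],
                    vector [- n\<^sup>2 - m\<^sup>2, m]]
          + (exp (t * m) * cos (t * n)) *\<^sub>R mat 1))"
proof -
  \<comment> \<open>\<open>d\<close> is the discriminant of the characteristic polynomial of
    \<open>G\<close>. Its sign selects the case, with \<open>d / 4\<close> equal to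
    \<open>n\<^sup>2\<close>, 0 or \<open>- n\<^sup>2\<close>, which brings \<open>G\<close> into
    the companion form treated above.\<close>
  define d where "d = (\<beta> * lam + \<gamma>)\<^sup>2 - 4 * (\<alpha> * lam + \<delta>)"
  have bm: "\<beta> * lam + \<gamma> = - 2 * m"
    unfolding assms(7) by (simp add: field_simps)
  have "- \<alpha> * lam - \<delta> = d / 4 - m\<^sup>2"
    unfolding d_def bm power_mult_distrib by (simp add: field_simps)
  moreover have "- \<beta> * lam - \<gamma> = 2 * m"
    using bm by linarith
  ultimately have G: "G = vector [vector [0, 1], vector [d / 4 - m\<^sup>2, 2 * m]]"
    using assms(6) by simp
  have distinct: "matrix_exp (t *\<^sub>R G) =
      ((exp (t * (m + n)) - exp (t * (m - n))) / (2 * n)) *\<^sub>R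
        vector [vector [- m - n, 1], vector [n\<^sup>2 - m\<^sup>2, m - n]]
      + exp (t * (m + n)) *\<^sub>R mat 1"
    if "d > 0" and "n = (1 / 2) * sqrt d" for n
  proof -
    have d: "d / 4 = n\<^sup>2" and "n \<noteq> 0"
      unfolding that(2) using that(1) by (simp_all add: power_mult_distrib power_divide)
    then show ?thesis
      unfolding G d using \<open>t > 0\<close> by (intro matrix_exp_companion_distinct) simp_all
  qed
  have double: "matrix_exp (t *\<^sub>R G) =
      exp (t * m) *\<^sub>R vector [vector [1 - t * m, t], vector [- t * m\<^sup>2, t * m + 1]]"
    if "d = 0"
    using matrix_exp_companion_double[of t m] that by (simp add: G)
  have complex: "matrix_exp (t *\<^sub>R G) =
      (exp (t * m) * sin (t * n) / n) *\<^sub>R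
        vector [vector [- m, 1], vector [- n\<^sup>2 - m\<^sup>2, m]]
      + (exp (t * m) * cos (t * n)) *\<^sub>R mat 1"
    if "d < 0" and "n = (1 / 2) * sqrt (- d)" for n
  proof -
    have d: "d / 4 = - n\<^sup>2" and "n \<noteq> 0"
      unfolding that(2) using that(1) by (simp_all add: power_mult_distrib power_divide)
    then show ?thesis
      unfolding G d using \<open>t > 0\<close> by (intro matrix_exp_companion_complex) simp_all
  qed
  show ?thesis
    unfolding Let_def by (intro conjI impI distinct double complex) (simp_all add: d_def)
qed

end
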